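(* Let $z_1,\ldots,z_n\in\partial\mathbb{D}$ be distinct and let $B$ be a Blaschke product of degree $n$ with $B(z_j)=1$ for $j=1,\ldots,n$. Assume that $B'(0)\neq0$. Then there exist $\zeta_1,\ldots,\zeta_{n-1}\in\mathbb{D}\setminus\{0\}$ such that the function $$W(w_1,\ldots,w_n)=\sum_{k=1}^{n-1}\sum_{j=1}^n\log|(w_j-\zeta_k)(w_j-\zeta_k^* )|-2\sum_{1\le j<k\le n}\log|w_j-w_k|$$ has a critical point at $(w_1,\ldots,w_n)=(z_1,\ldots,z_n)$, even when $W$ is regarded as a function of $(w_1,\ldots,w_n)\in\mathbb{C}^n$ (near $(z_1,\ldots,z_n)$). Moreover, the restriction $W|_{(\partial\mathbb{D})^n}$ has a global minimum at $(z_1,\ldots,z_n)$.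
   Context: $\mathbb{D}=\{z\in\mathbb{C}:|z|<1\}$, $\partial\mathbb{D}=\{|z|=1\}$, $\zeta^*=1/\overline\zeta$ for $\zeta\neq0$. A Blaschke product of degree $n$ is $B(z)=\chi\prod_{k=1}^n\frac{z-a_k}{1-\overline{a_k}z}$ with $|\chi|=1$, $a_1,\ldots,a_n\in\mathbb{D}$. (By a known interpolation theorem of Jones–Ruscheweyh and Hjelle, for any distinct $z_1,\ldots,z_n\in\partial\mathbb{D}$ there is a Blaschke product of degree $n$ with $B(z_j)=1$ for all $j$; it is not unique.) On $(\partial\mathbb{D})^n$, $W$ takes the value $+\infty$ when $w_j=w_k$ for some $j\ne k$. A critical point of $W$ as a function on $\mathbb{C}^n$ means that the full real gradient of $W$ (in $\mathbb{C}^n\cong\mathbb{R}^{2n}$) vanishes. *)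

theory Defs
  imports "HOL-Analysis.Analysis"
begin

definition blaschke_product :: "nat \<Rightarrow> (complex \<Rightarrow> complex) \<Rightarrow> bool" where
  "blaschke_product n B \<longleftrightarrow>
     (\<exists>c a. norm c = 1 \<and> (\<forall>k\<in>{1..n}. norm (a k) < 1) \<and>
        B = (\<lambda>z. c * (\<Prod>k=1..n. (z - a k) / (1 - cnj (a k) * z))))"

definition reflect :: "complex \<Rightarrow> complex" where
  "reflect \<zeta> = 1 / cnj \<zeta>"

text \<open>
  The points \<open>w\<^sub>1, \<dots>, w\<^sub>n\<close> form a vector in \<^typ>\<open>complex ^ 'n\<close> with \<open>n = CARD('n)\<close>. The order on
  the index type only serves to count every unordered pair of indices once.

  \<open>W\<close> is meant where no argument of a logarithm vanishes. This is the case in a neighbourhood of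
  every point of the torus with pairwise distinct coordinates, provided \<open>0 < norm (\<zeta> k) < 1\<close>.
  Elsewhere the convention \<open>ln 0 = 0\<close> yields meaningless values; \<open>W_torus\<close> below has the
  intended value at the points of the torus where coordinates coincide.
\<close>

definition W :: "(nat \<Rightarrow> complex) \<Rightarrow> complex ^ 'n::{finite,linorder} \<Rightarrow> real" where
  "W \<zeta> w =
     (\<Sum>k=1..CARD('n) - 1. \<Sum>j\<in>UNIV. ln (norm ((w $ j - \<zeta> k) * (w $ j - reflect (\<zeta> k)))))
     - 2 * (\<Sum>j\<in>UNIV. \<Sum>k\<in>{j<..}. ln (norm (w $ j - w $ k)))"

definition torus :: "(complex ^ 'n) set" where
  "torus = {w. \<forall>j. norm (w $ j) = 1}"

definition W_torus :: "(nat \<Rightarrow> complex) \<Rightarrow> complex ^ 'n::{finite,linorder} \<Rightarrow> ereal" where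
  "W_torus \<zeta> w = (if \<exists>j k. j \<noteq> k \<and> w $ j = w $ k then \<infinity> else ereal (W \<zeta> w))"

end

theory Submission
  imports Defs "HOL-Computational_Algebra.Fundamental_Theorem_Algebra"
begin

text \<open>
  Write \<open>B = P / Q\<close> with the polynomials \<open>P = c \<Prod>(x - a\<^sub>k)\<close> and \<open>Q = \<Prod>(1 - cnj a\<^sub>k x)\<close>, and let
  \<open>N = P' Q - P Q'\<close>, the numerator of \<open>B'\<close>. The \<open>\<zeta>\<^sub>k\<close> are the zeros of \<open>N\<close>, that is, the critical
  points of \<open>B\<close>, in the open disc. On the unit circle \<open>N(w) = c w\<^bsup>n-1\<^esup> \<rho>(w)\<close> with \<open>\<rho> > 0\<close>, so \<open>N\<close> has
  no zeros there and is invariant under reflection up to a constant; as \<open>N(0) = B'(0) \<noteq> 0\<close>, its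
  zeros form \<open>n - 1\<close> pairs \<open>\<zeta>\<^sub>k, \<zeta>\<^sub>k\<^sup>*\<close>. Up to an additive constant, therefore,
  \<open>W(w) = \<Sum>\<^sub>j ln |N(w\<^sub>j)| - 2 ln |V(w)|\<close> with the Vandermonde determinant \<open>V\<close>.

  Everything else rests on one identity. Let \<open>L\<^sub>k\<close> be the Lagrange basis polynomials of the nodes
  \<open>z\<^sub>1, \<dots>, z\<^sub>n\<close>. As \<open>P = Q\<close> at the nodes, \<open>P - Q\<close> is a multiple of \<open>\<Prod>(x - z\<^sub>k)\<close>, and
  interpolation of \<open>Q\<close> gives

  \<open>N = \<Sum>\<^sub>k N(z\<^sub>k) L\<^sub>k\<^sup>2\<close>  (lemma \<open>wronskian_eq_sum_lagrange_squares\<close>).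

  Critical point: differentiating the identity at \<open>z\<^sub>j\<close> gives
  \<open>N'(z\<^sub>j) / N(z\<^sub>j) = 2 L\<^sub>j'(z\<^sub>j) = 2 \<Sum>\<^bsub>m\<noteq>j\<^esub> 1 / (z\<^sub>j - z\<^sub>m)\<close>. The left side is
  \<open>\<Sum>\<^sub>k (1 / (z\<^sub>j - \<zeta>\<^sub>k) + 1 / (z\<^sub>j - \<zeta>\<^sub>k\<^sup>*))\<close>, so the complex derivative of \<open>W\<close> with respect to the
  coordinate \<open>w\<^sub>j\<close> vanishes.

  Minimum: at a fixed point \<open>w\<close> of the circle all the terms of the identity have the same argument,
  so \<open>|N(w)| = \<Sum>\<^sub>k |N(z\<^sub>k)| |L\<^sub>k(w)|\<^sup>2\<close>. Hence the matrix \<open>(L\<^sub>k(w\<^sub>j) |N(z\<^sub>k)|\<^bsup>1/2\<^esup>)\<^sub>j\<^sub>k\<close> has rows of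
  norm \<open>|N(w\<^sub>j)|\<^bsup>1/2\<^esup>\<close>. Its determinant is \<open>V(w) / V(z) \<Prod>\<^sub>k |N(z\<^sub>k)|\<^bsup>1/2\<^esup>\<close>, and Hadamard's inequality
  (lemma \<open>hadamard_inequality\<close>) says precisely that \<open>W(z) \<le> W(w)\<close>.
\<close>

section \<open>Lagrange interpolation and the Wronskian\<close>

definition node_poly :: "('n::finite \<Rightarrow> 'a::field) \<Rightarrow> 'a poly" where
  "node_poly z = (\<Prod>k\<in>UNIV. [:- z k, 1:])"

definition lagrange :: "('n::finite \<Rightarrow> 'a::field) \<Rightarrow> 'n \<Rightarrow> 'a poly" where
  "lagrange z k = smult (1 / (\<Prod>m\<in>-{k}. z k - z m)) (\<Prod>m\<in>-{k}. [:- z m, 1:])"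

definition wronskian :: "'a::field poly \<Rightarrow> 'a poly \<Rightarrow> 'a poly" where
  "wronskian p q = pderiv p * q - p * pderiv q"

lemma wronskian_smult_left: "wronskian (smult c p) q = smult c (wronskian p q)"
  by (simp add: wronskian_def pderiv_smult smult_diff_right)

lemma pderiv_sum: "pderiv (\<Sum>k\<in>S. f k) = (\<Sum>k\<in>S. pderiv (f k))"
  by (induction S rule: infinite_finite_induct) (simp_all add: pderiv_add)

lemma smult_sum_right: "smult c (\<Sum>k\<in>S. f k) = (\<Sum>k\<in>S. smult c (f k))"
  by (induction S rule: infinite_finite_induct) (simp_all add: smult_add_right)

lemma log_deriv_prod:
  fixes f :: "'i \<Rightarrow> 'a::field poly"
  assumes "\<And>k. k \<in> S \<Longrightarrow> poly (f k) x \<noteq> 0"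
  shows "poly (pderiv (prod f S)) x = poly (prod f S) x * (\<Sum>k\<in>S. poly (pderiv (f k)) x / poly (f k) x)"
  using assms
  by (induction S rule: infinite_finite_induct) (simp_all add: pderiv_mult field_simps)

lemma monic_prod_linear:
  fixes z :: "'n \<Rightarrow> 'a::field"
  assumes "finite S"
  shows "degree (\<Prod>k\<in>S. [:- z k, 1:]) = card S" "coeff (\<Prod>k\<in>S. [:- z k, 1:]) (card S) = 1"
proof -
  show *: "degree (\<Prod>k\<in>S. [:- z k, 1:]) = card S"
    by (subst degree_prod_sum_eq) auto
  show "coeff (\<Prod>k\<in>S. [:- z k, 1:]) (card S) = 1"
    using lead_coeff_prod[of "\<lambda>k. [:- z k, 1:]" S] unfolding * by simp
qed

lemma poly_lagrange: "poly (lagrange z k) x = (\<Prod>m\<in>-{k}. (x - z m) / (z k - z m))"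
  by (simp add: lagrange_def poly_prod prod_dividef)

lemma poly_lagrange_node:
  assumes "inj z"
  shows "poly (lagrange z k) (z j) = (if j = k then 1 else 0)"
proof (cases "j = k")
  case True
  then show ?thesis unfolding poly_lagrange
    by (auto intro!: prod.neutral simp: inj_eq[OF assms])
next
  case False
  then show ?thesis unfolding poly_lagrange by (auto intro!: prod_zero)
qed

lemma degree_lagrange_less: "degree (lagrange (z :: 'n::finite \<Rightarrow> _) k) < CARD('n)"
proof -
  have "degree (lagrange z k) \<le> card (-{k})"
    unfolding lagrange_def by (rule order_trans[OF degree_smult_le]) (simp add: monic_prod_linear)
  also have "\<dots> < CARD('n)" by (intro psubset_card_mono) auto
  finally show ?thesis .
qed

text \<open>
  One degree more than usual is allowed: a polynomial whose degree equals the number of nodes is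
  recovered from its values and its top coefficient, because the difference of the two sides has
  degree less than \<open>n\<close> and vanishes at the \<open>n\<close> nodes.
\<close>

lemma lagrange_interpolation:
  fixes z :: "'n::finite \<Rightarrow> 'a::field"
  assumes "inj z" and deg: "degree p \<le> CARD('n)"
  shows "p = smult (coeff p CARD('n)) (node_poly z) + (\<Sum>k\<in>UNIV. smult (poly p (z k)) (lagrange z k))"
proof -
  let ?n = "CARD('n)"
  define r where "r = p - (smult (coeff p ?n) (node_poly z) + (\<Sum>k\<in>UNIV. smult (poly p (z k)) (lagrange z k)))"
  have node: "degree (node_poly z) = ?n" "coeff (node_poly z) ?n = 1"
    unfolding node_poly_def by (simp_all add: monic_prod_linear)
  have ds: "degree (\<Sum>k\<in>UNIV. smult (poly p (z k)) (lagrange z k)) < ?n"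
    by (intro degree_sum_less) (auto intro: le_less_trans[OF degree_smult_le] degree_lagrange_less)
  have "degree (smult (coeff p ?n) (node_poly z)) \<le> ?n"
    using degree_smult_le[of "coeff p ?n" "node_poly z"] node by simp
  then have "degree r \<le> ?n"
    unfolding r_def using deg ds by (intro degree_diff_le degree_add_le) auto
  moreover have "coeff r ?n = 0"
    unfolding r_def using node coeff_eq_0[OF ds] by simp
  ultimately have dr: "degree r < ?n \<or> r = 0"
    by (metis le_neq_implies_less leading_coeff_0_iff)
  have zero: "poly r (z j) = 0" for j
  proof -
    have "poly (node_poly z) (z j) = 0"
      unfolding node_poly_def poly_prod by (auto intro!: prod_zero)
    then show ?thesis unfolding r_def
      by (simp add: poly_sum poly_lagrange_node[OF \<open>inj z\<close>] if_distrib[of "(*) _"] cong: if_cong)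
  qed
  have "r = 0"
  proof (rule ccontr)
    assume "r \<noteq> 0"
    have "card (range z) \<le> card {x. poly r x = 0}"
      using zero poly_roots_finite[OF \<open>r \<noteq> 0\<close>] by (intro card_mono) auto
    also have "\<dots> \<le> degree r" using \<open>r \<noteq> 0\<close> by (rule card_poly_roots_bound)
    finally show False using dr \<open>r \<noteq> 0\<close> card_image[OF \<open>inj z\<close>] by simp
  qed
  then show ?thesis unfolding r_def by simp
qed

text \<open>
  For the node polynomial \<open>F = d (x - z\<^sub>k) L\<^sub>k\<close>, with a constant \<open>d\<close>, the terms that contain \<open>L\<^sub>k'\<close> cancel in \<open>F' L\<^sub>k - F L\<^sub>k'\<close>, and what is left
  comes from the derivative of the linear factor.
\<close>

lemma wronskian_node_lagrange:
  assumes "inj z"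
  shows "wronskian (node_poly z) (lagrange z k) = smult (\<Prod>m\<in>-{k}. z k - z m) ((lagrange z k)\<^sup>2)"
proof -
  define d where "d = (\<Prod>m\<in>-{k}. z k - z m)"
  define l where "l = lagrange z k"
  have "d \<noteq> 0" unfolding d_def using assms by (auto simp: inj_def)
  have "node_poly z = [:- z k, 1:] * (\<Prod>m\<in>-{k}. [:- z m, 1:])"
    unfolding node_poly_def by (subst prod.remove[of _ k]) (auto simp: Compl_eq_Diff_UNIV)
  also have "(\<Prod>m\<in>-{k}. [:- z m, 1:]) = smult d l"
    unfolding l_def lagrange_def d_def[symmetric] using \<open>d \<noteq> 0\<close> by simp
  finally have F: "node_poly z = smult d ([:- z k, 1:] * l)" by simp
  have "wronskian (node_poly z) l = smult d (wronskian ([:- z k, 1:] * l) l)"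
    unfolding F wronskian_smult_left ..
  also have "pderiv [:- z k, 1:] = 1" by (simp add: pderiv_pCons)
  then have "wronskian ([:- z k, 1:] * l) l = l\<^sup>2"
    unfolding wronskian_def pderiv_mult by (simp add: power2_eq_square algebra_simps del: mult_pCons_left mult_pCons_right)
  finally show ?thesis by (simp add: l_def d_def)
qed

text \<open>
  Since \<open>p\<close> and \<open>q\<close> agree at the nodes, \<open>p = q + c F\<close> with the node polynomial \<open>F\<close>, so the
  Wronskian of \<open>p\<close> and \<open>q\<close> is \<open>c\<close> times that of \<open>F\<close> and \<open>q\<close>. Interpolating \<open>q\<close>, the multiple of \<open>F\<close>
  drops out and each Lagrange polynomial contributes its square.
\<close>

lemma wronskian_eq_sum_lagrange_squares:
  fixes z :: "'n::finite \<Rightarrow> 'a::field"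
  assumes "inj z" and degp: "degree p \<le> CARD('n)" and degq: "degree q \<le> CARD('n)"
    and eq: "\<And>k. poly p (z k) = poly q (z k)"
  shows "wronskian p q = (\<Sum>k\<in>UNIV. smult (poly (wronskian p q) (z k)) ((lagrange z k)\<^sup>2))"
proof -
  let ?F = "node_poly z"
  define c where "c = coeff (p - q) CARD('n)"
  define d where "d = coeff q CARD('n)"
  define b where "b k = c * poly q (z k) * (\<Prod>m\<in>-{k}. z k - z m)" for k
  have pq: "p = q + smult c ?F"
    using lagrange_interpolation[OF \<open>inj z\<close>, of "p - q"] degp degq eq
    by (simp add: degree_diff_le c_def algebra_simps)
  have q: "q = smult d ?F + (\<Sum>k\<in>UNIV. smult (poly q (z k)) (lagrange z k))"
    unfolding d_def by (rule lagrange_interpolation[OF \<open>inj z\<close> degq])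
  have pdq: "pderiv q = smult d (pderiv ?F) + (\<Sum>k\<in>UNIV. smult (poly q (z k)) (pderiv (lagrange z k)))"
    by (subst q) (simp add: pderiv_add pderiv_smult pderiv_sum)
  have "wronskian p q = smult c (wronskian ?F q)"
    unfolding wronskian_def pq by (simp add: pderiv_add pderiv_smult algebra_simps smult_diff_right)
  also have "wronskian ?F q = (\<Sum>k\<in>UNIV. smult (poly q (z k)) (wronskian ?F (lagrange z k)))"
    unfolding wronskian_def pdq
    by (subst (1) q) (simp add: algebra_simps sum_distrib_left sum_distrib_right smult_diff_right sum_subtractf)
  also have "smult c \<dots> = (\<Sum>k\<in>UNIV. smult (b k) ((lagrange z k)\<^sup>2))"
    by (simp add: wronskian_node_lagrange[OF \<open>inj z\<close>] b_def smult_sum_right mult.assoc)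
  finally have *: "wronskian p q = (\<Sum>k\<in>UNIV. smult (b k) ((lagrange z k)\<^sup>2))" .
  have "poly (wronskian p q) (z k) = b k" for k
    unfolding * by (simp add: poly_sum poly_lagrange_node[OF \<open>inj z\<close>] if_distrib[of "(*) _"]
        if_distrib[of "\<lambda>x. x^2"] cong: if_cong)
  then show ?thesis using * by simp
qed

lemma pderiv_lagrange_node:
  assumes "inj z"
  shows "poly (pderiv (lagrange z k)) (z k) = (\<Sum>m\<in>-{k}. 1 / (z k - z m))"
proof -
  have "poly (pderiv (lagrange z k)) (z k) = poly (lagrange z k) (z k) * (\<Sum>m\<in>-{k}. 1 / (z k - z m))"
    unfolding lagrange_def pderiv_smult poly_smult
    by (subst log_deriv_prod) (use inj_eq[OF assms] in \<open>auto simp: pderiv_pCons\<close>)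
  then show ?thesis by (simp add: poly_lagrange_node[OF assms])
qed

text \<open>
  At the node \<open>z\<^sub>j\<close> every \<open>L\<^sub>k\<close> with \<open>k \<noteq> j\<close> vanishes, hence so does the derivative of \<open>L\<^sub>k\<^sup>2\<close>. This is the
  stationarity of the energy in disguise.
\<close>

lemma pderiv_sum_lagrange_squares:
  fixes N :: "'a::field poly"
  assumes "inj z" and N: "N = (\<Sum>k\<in>UNIV. smult (poly N (z k)) ((lagrange z k)\<^sup>2))"
  shows "poly (pderiv N) (z j) = 2 * poly N (z j) * (\<Sum>m\<in>-{j}. 1 / (z j - z m))"
proof -
  have "poly (pderiv N) (z j) =
      (\<Sum>k\<in>UNIV. poly N (z k) * (2 * poly (lagrange z k) (z j) * poly (pderiv (lagrange z k)) (z j)))"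
    by (subst N) (simp add: pderiv_sum pderiv_smult poly_sum power2_eq_square pderiv_mult mult.assoc)
  also have "\<dots> = poly N (z j) * (2 * poly (pderiv (lagrange z j)) (z j))"
    by (subst sum.remove[of _ j]) (auto simp: poly_lagrange_node[OF \<open>inj z\<close>])
  finally show ?thesis by (simp add: pderiv_lagrange_node[OF \<open>inj z\<close>])
qed

section \<open>Polynomials of constant phase on the unit circle\<close>

text \<open>
  The square of a chord of the unit circle has the argument of \<open>- w a\<close>, which is the product of a
  factor depending on \<open>w\<close> only and one depending on \<open>a\<close> only. This is why the argument of \<open>L\<^sub>k(w)\<^sup>2\<close> below
  is given by such a simple formula.
\<close>

lemma unit_circle_diff_square:
  fixes w a :: complex
  assumes "norm w = 1" "norm a = 1"
  shows "(w - a)\<^sup>2 = - (w * a) * (norm (w - a))\<^sup>2"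
proof -
  have "w * cnj w = 1" "a * cnj a = 1"
    using assms by (simp_all add: complex_norm_square[symmetric])
  then show ?thesis unfolding complex_norm_square complex_cnj_diff by algebra
qed

lemma lagrange_square_on_circle:
  fixes z :: "'n::finite \<Rightarrow> complex"
  assumes "\<And>k. norm (z k) = 1" and w: "norm w = 1"
  shows "(poly (lagrange z k) w)\<^sup>2 = (w / z k) ^ (CARD('n) - 1) * (norm (poly (lagrange z k) w))\<^sup>2"
proof -
  have nz: "z j \<noteq> 0" for j using assms(1)[of j] by auto
  have "((w - z m) / (z k - z m))\<^sup>2 = w / z k * (norm ((w - z m) / (z k - z m)))\<^sup>2" for m
    unfolding power_divide norm_divide of_real_divide
    using unit_circle_diff_square[OF w assms(1)] unit_circle_diff_square[OF assms(1) assms(1)] nz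
    by (simp add: divide_simps)
  then have "(poly (lagrange z k) w)\<^sup>2 = (\<Prod>m\<in>-{k}. w / z k * (norm ((w - z m) / (z k - z m)))\<^sup>2)"
    unfolding poly_lagrange prod_power_distrib by simp
  also have "\<dots> = (w / z k) ^ card (-{k}) * (norm (poly (lagrange z k) w))\<^sup>2"
    unfolding poly_lagrange prod_norm[symmetric] prod.distrib prod_power_distrib by simp
  also have "card (-{k}) = CARD('n) - 1" by (simp add: Compl_eq_Diff_UNIV)
  finally show ?thesis .
qed

text \<open>
  A polynomial with this property is self-inversive and has no zeros on the unit circle. The factor
  \<open>\<rho>\<close> matters on the circle only.
\<close>

definition circle_phase :: "nat \<Rightarrow> complex poly \<Rightarrow> complex \<Rightarrow> (complex \<Rightarrow> real) \<Rightarrow> bool" where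
  "circle_phase m N c \<rho> \<longleftrightarrow> c \<noteq> 0 \<and> (\<forall>w. norm w = 1 \<longrightarrow> \<rho> w > 0 \<and> poly N w = c * w ^ m * of_real (\<rho> w))"

text \<open>
  The argument of \<open>N(z\<^sub>k)\<close> is that of \<open>c z\<^sub>k\<^bsup>n-1\<^esup>\<close> and the argument of \<open>L\<^sub>k(w)\<^sup>2\<close> is that of
  \<open>(w / z\<^sub>k)\<^bsup>n-1\<^esup>\<close>. The product of the two does not depend on \<open>k\<close>, so there is no cancellation in the sum.
\<close>

lemma norm_sum_lagrange_squares:
  fixes z :: "'n::finite \<Rightarrow> complex"
  assumes z: "\<And>k. norm (z k) = 1" and w: "norm w = 1"
    and phase: "circle_phase (CARD('n) - 1) N c \<rho>"
    and N: "N = (\<Sum>k\<in>UNIV. smult (poly N (z k)) ((lagrange z k)\<^sup>2))"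
  shows "norm (poly N w) = (\<Sum>k\<in>UNIV. norm (poly N (z k)) * (norm (poly (lagrange z k) w))\<^sup>2)"
proof -
  let ?m = "CARD('n) - 1"
  have nz: "z j \<noteq> 0" "w \<noteq> 0" for j using z[of j] w by auto
  have c: "c \<noteq> 0" and val: "\<And>x. norm x = 1 \<Longrightarrow> poly N x = c * x ^ ?m * of_real (\<rho> x)"
    and pos: "\<And>x. norm x = 1 \<Longrightarrow> \<rho> x > 0"
    using phase unfolding circle_phase_def by auto
  have "c * w ^ ?m * of_real (\<rho> w) = (\<Sum>k\<in>UNIV. poly N (z k) * (poly (lagrange z k) w)\<^sup>2)"
    unfolding val[OF w, symmetric] by (subst N) (simp add: poly_sum)
  also have "\<dots> = c * w ^ ?m * of_real (\<Sum>k\<in>UNIV. \<rho> (z k) * (norm (poly (lagrange z k) w))\<^sup>2)"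
    unfolding of_real_sum sum_distrib_left
    by (intro sum.cong refl)
       (simp add: val[OF z] lagrange_square_on_circle[OF z w] power_divide nz)
  finally have "\<rho> w = (\<Sum>k\<in>UNIV. \<rho> (z k) * (norm (poly (lagrange z k) w))\<^sup>2)"
    using c nz by (simp flip: of_real_power of_real_mult of_real_sum)
  moreover have "norm (poly N x) = norm c * \<rho> x" if "norm x = 1" for x
    using val[OF that] pos[OF that] by (simp add: norm_mult norm_power that)
  ultimately show ?thesis by (simp add: w z sum_distrib_left mult.assoc)
qed

section \<open>The Wronskian of a Blaschke product\<close>

definition blaschke_num :: "complex \<Rightarrow> (nat \<Rightarrow> complex) \<Rightarrow> nat \<Rightarrow> complex poly" where
  "blaschke_num c a n = smult c (\<Prod>k=1..n. [:- a k, 1:])"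

definition blaschke_den :: "(nat \<Rightarrow> complex) \<Rightarrow> nat \<Rightarrow> complex poly" where
  "blaschke_den a n = (\<Prod>k=1..n. [:1, - cnj (a k):])"

text \<open>
  This is the formula \<open>w B'(w) / B(w) = \<Sum>\<^sub>k (1 - |a\<^sub>k|\<^sup>2) / |w - a\<^sub>k|\<^sup>2\<close> on the circle, with the
  denominators cleared: there \<open>1 - cnj a w = w cnj (w - a)\<close>, so each factor of \<open>P Q\<close> is
  \<open>w |w - a|\<^sup>2\<close>.
\<close>

lemma wronskian_blaschke_on_circle:
  assumes w: "norm w = 1"
  shows "poly (wronskian (blaschke_num c a n) (blaschke_den a n)) w =
    c * w ^ (n - 1) * of_real (\<Sum>k=1..n. (1 - (norm (a k))\<^sup>2) * (\<Prod>l\<in>{1..n}-{k}. (norm (w - a l))\<^sup>2))"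
proof -
  define p where "p l = w - a l" for l
  define q where "q l = 1 - cnj (a l) * w" for l
  have w1: "w * cnj w = 1" using w by (simp add: complex_norm_square[symmetric])
  have pq: "p l * q l = w * (norm (w - a l))\<^sup>2" for l
    unfolding p_def q_def complex_norm_square complex_cnj_diff using w1 by algebra
  have split: "prod f {1..n} = f k * prod f ({1..n}-{k})" if "k \<in> {1..n}" for f :: "nat \<Rightarrow> complex" and k
    using that by (simp add: prod.remove)
  have dp: "poly (pderiv (blaschke_num c a n)) w = c * (\<Sum>k=1..n. prod p ({1..n}-{k}))"
    unfolding blaschke_num_def pderiv_smult pderiv_prod
    by (simp add: poly_sum poly_prod pderiv_pCons p_def)
  have dq: "poly (pderiv (blaschke_den a n)) w = (\<Sum>k=1..n. - cnj (a k) * prod q ({1..n}-{k}))"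
    unfolding blaschke_den_def pderiv_prod
    by (simp add: poly_sum poly_prod pderiv_pCons q_def mult.commute)
  have P: "poly (blaschke_num c a n) w = c * prod p {1..n}" "poly (blaschke_den a n) w = prod q {1..n}"
    by (simp_all add: blaschke_num_def blaschke_den_def p_def q_def poly_prod mult.commute)
  have "poly (wronskian (blaschke_num c a n) (blaschke_den a n)) w =
      (\<Sum>k=1..n. c * (prod p ({1..n}-{k}) * prod q {1..n} + cnj (a k) * prod p {1..n} * prod q ({1..n}-{k})))"
    unfolding wronskian_def
    by (simp add: dp dq P sum_distrib_left sum_distrib_right algebra_simps sum.distrib sum_negf)
  also have "\<dots> = (\<Sum>k=1..n. c * w ^ (n - 1) * of_real ((1 - (norm (a k))\<^sup>2) * (\<Prod>l\<in>{1..n}-{k}. (norm (w - a l))\<^sup>2)))"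
  proof (rule sum.cong)
    fix k assume k: "k \<in> {1..n}"
    have "prod p ({1..n}-{k}) * prod q {1..n} + cnj (a k) * prod p {1..n} * prod q ({1..n}-{k})
       = (q k + cnj (a k) * p k) * (\<Prod>l\<in>{1..n}-{k}. p l * q l)"
      unfolding split[OF k] prod.distrib by (simp add: algebra_simps)
    also have "q k + cnj (a k) * p k = of_real (1 - (norm (a k))\<^sup>2)"
      unfolding of_real_diff complex_norm_square p_def q_def by (simp add: algebra_simps)
    also have "(\<Prod>l\<in>{1..n}-{k}. p l * q l) = w ^ (n - 1) * of_real (\<Prod>l\<in>{1..n}-{k}. (norm (w - a l))\<^sup>2)"
      unfolding pq prod.distrib using k by simp
    finally show "c * (prod p ({1..n}-{k}) * prod q {1..n} + cnj (a k) * prod p {1..n} * prod q ({1..n}-{k}))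
      = c * w ^ (n - 1) * of_real ((1 - (norm (a k))\<^sup>2) * (\<Prod>l\<in>{1..n}-{k}. (norm (w - a l))\<^sup>2))" by simp
  qed simp
  finally show ?thesis by (simp add: sum_distrib_left)
qed

lemma circle_phase_wronskian_blaschke:
  assumes "n \<ge> 1" "c \<noteq> 0" and a: "\<And>k. k \<in> {1..n} \<Longrightarrow> norm (a k) < 1"
  shows "\<exists>\<rho>. circle_phase (n - 1) (wronskian (blaschke_num c a n) (blaschke_den a n)) c \<rho>"
proof -
  define \<rho> where "\<rho> w = (\<Sum>k=1..n. (1 - (norm (a k))\<^sup>2) * (\<Prod>l\<in>{1..n}-{k}. (norm (w - a l))\<^sup>2))" for w
  have "\<rho> w > 0" if "norm w = 1" for w
    unfolding \<rho>_def
  proof (rule sum_pos)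
    fix k assume k: "k \<in> {1..n}"
    have "(norm (a k))\<^sup>2 < 1" using a[OF k] by (simp add: power_less_one_iff abs_square_less_1)
    moreover have "(norm (w - a l))\<^sup>2 > 0" if "l \<in> {1..n}" for l using a[OF that] \<open>norm w = 1\<close> by auto
    ultimately show "(1 - (norm (a k))\<^sup>2) * (\<Prod>l\<in>{1..n}-{k}. (norm (w - a l))\<^sup>2) > 0"
      by (intro mult_pos_pos prod_pos) auto
  qed (use assms in auto)
  then show ?thesis
    using \<open>c \<noteq> 0\<close> unfolding circle_phase_def
    by (intro exI[of _ \<rho>]) (simp add: wronskian_blaschke_on_circle \<rho>_def)
qed

text \<open>
  This holds at every point, including the poles, because division by zero yields zero on both sides.
\<close>

lemma blaschke_eq_quotient:
  "c * (\<Prod>k=1..n. (x - a k) / (1 - cnj (a k) * x)) = poly (blaschke_num c a n) x / poly (blaschke_den a n) x"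
  by (simp add: blaschke_num_def blaschke_den_def poly_prod prod_dividef mult.commute)

lemma degree_prod_linear_le: "degree (\<Prod>k=1..n. [:f k, g k:]) \<le> n"
proof -
  have "degree (\<Prod>k=1..n. [:f k, g k:]) \<le> (\<Sum>k=1..n. degree [:f k, g k:])"
    using degree_prod_sum_le[of "{1..n}" "\<lambda>k. [:f k, g k:]"] by (simp add: comp_def)
  also have "\<dots> \<le> (\<Sum>k=1..n. 1)" by (intro sum_mono) simp
  finally show ?thesis by simp
qed

section \<open>Factorization into reflected pairs of roots\<close>

text \<open>
  On the circle conjugation and inversion coincide, so the reversed conjugate polynomial
  \<open>R(w) = w\<^sup>d cnj (N (1 / cnj w))\<close> with \<open>d = degree N\<close> satisfies \<open>c w\<^bsup>2m\<^esup> R(w) = cnj c w\<^sup>d N(w)\<close> there,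
  hence everywhere. Comparing degrees gives \<open>d = 2m\<close>, because \<open>R\<close> has degree \<open>d\<close> when
  \<open>N(0) \<noteq> 0\<close>; comparing zeros gives their symmetry.
\<close>

lemma circle_phase_reflect:
  assumes phase: "circle_phase m N c \<rho>" and N0: "poly N 0 \<noteq> 0"
  shows "degree N = 2 * m"
    and "poly N r = 0 \<Longrightarrow> poly N (reflect r) = 0"
proof -
  define R where "R = reflect_poly (map_poly cnj N)"
  define d where "d = degree N"
  have c: "c \<noteq> 0" and val: "\<And>x. norm x = 1 \<Longrightarrow> poly N x = c * x ^ m * of_real (\<rho> x)"
    using phase unfolding circle_phase_def by auto
  have dc: "degree (map_poly cnj N) = d" by (simp add: degree_map_poly d_def)
  have R: "poly R w = w ^ d * cnj (poly N (reflect w))" if "w \<noteq> 0" for w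
    using that unfolding R_def by (simp add: poly_reflect_poly_nz dc reflect_def inverse_eq_divide)
  have "poly (monom c (2 * m) * R) w = poly (monom (cnj c) d * N) w" if w: "norm w = 1" for w
  proof -
    have "w \<noteq> 0" using w by auto
    have 1: "w * cnj w = 1" using w by (simp add: complex_norm_square[symmetric])
    then have "reflect w = w" using \<open>w \<noteq> 0\<close> unfolding reflect_def by (simp add: field_simps)
    moreover have "w ^ m * cnj w ^ m = 1" using 1 by (simp flip: power_mult_distrib)
    ultimately show ?thesis
      by (simp add: poly_monom R[OF \<open>w \<noteq> 0\<close>] val[OF w] power_mult power2_eq_square
          power_mult_distrib mult_2 power_add algebra_simps)
  qed
  then have "sphere 0 1 \<subseteq> {w. poly (monom c (2 * m) * R - monom (cnj c) d * N) w = 0}" by auto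
  moreover have "infinite (sphere (0::complex) 1)"
  proof
    assume "finite (sphere (0::complex) 1)"
    moreover have "connected (sphere (0::complex) 1)" by (intro connected_sphere) simp
    moreover have "1 \<in> sphere (0::complex) 1" "-1 \<in> sphere (0::complex) 1" by simp_all
    ultimately show False using connected_finite_iff_sing by (metis empty_iff one_neq_neg_one singletonD)
  qed
  ultimately have eq: "monom c (2 * m) * R = monom (cnj c) d * N"
    by (metis eq_iff_diff_eq_0 finite_subset poly_roots_finite)
  have "N \<noteq> 0" using N0 by auto
  then have "R \<noteq> 0" "degree R = d"
    using N0 dc by (auto simp: R_def degree_reflect_poly_eq coeff_map_poly poly_0_coeff_0 map_poly_eq_0_iff)
  then show deg: "degree N = 2 * m"
    using arg_cong[OF eq, of degree] c \<open>N \<noteq> 0\<close> by (simp add: degree_mult_eq degree_monom_eq d_def monom_eq_0_iff)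
  assume r: "poly N r = 0"
  then have "r \<noteq> 0" using N0 by auto
  have "c * r ^ (2 * m) * poly R r = 0"
    using arg_cong[OF eq, of "\<lambda>p. poly p r"] r by (simp add: poly_monom)
  then show "poly N (reflect r) = 0" using c \<open>r \<noteq> 0\<close> by (simp add: R)
qed

lemma reflect_reflect [simp]: "reflect (reflect x) = x"
  by (simp add: reflect_def)

lemma norm_reflect: "norm (reflect x) = 1 / norm x"
  by (simp add: reflect_def norm_divide)

text \<open>
  Dividing a polynomial by a pair of linear factors at \<open>x\<close> and its reflection lowers the exponent of
  \<open>w\<close> on the circle by one and changes the rest by a constant and a positive factor only.
\<close>

lemma circle_diff_mult_reflect:
  assumes "norm w = 1" "x \<noteq> 0"
  shows "(w - x) * (w - reflect x) = - (w / cnj x) * of_real ((norm (w - x))\<^sup>2)"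
proof -
  have "w * cnj w = 1" using assms by (simp add: complex_norm_square[symmetric])
  moreover have "cnj x * reflect x = 1" using assms by (simp add: reflect_def)
  ultimately have "cnj x * ((w - x) * (w - reflect x)) = - w * of_real ((norm (w - x))\<^sup>2)"
    unfolding complex_norm_square complex_cnj_diff by algebra
  then show ?thesis using \<open>x \<noteq> 0\<close> by (simp add: field_simps)
qed

definition reflected_product :: "complex \<Rightarrow> (nat \<Rightarrow> complex) \<Rightarrow> nat \<Rightarrow> complex poly" where
  "reflected_product \<kappa> \<zeta> m = smult \<kappa> (\<Prod>k=1..m. [:- \<zeta> k, 1:] * [:- reflect (\<zeta> k), 1:])"

lemma poly_reflected_product:
  "poly (reflected_product \<kappa> \<zeta> m) x = \<kappa> * (\<Prod>k=1..m. (x - \<zeta> k) * (x - reflect (\<zeta> k)))"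
  by (simp add: reflected_product_def poly_prod algebra_simps)

text \<open>
  Split off one pair of reflected roots at a time. The quotient has the same kind of phase on the
  circle with \<open>m\<close> lowered by one, so the induction counts multiplicities by itself.
\<close>

lemma circle_phase_factorization:
  assumes "circle_phase m N c \<rho>" "poly N 0 \<noteq> 0"
  shows "\<exists>\<kappa> \<zeta>. \<kappa> \<noteq> 0 \<and> (\<forall>k\<in>{1..m}. \<zeta> k \<in> ball 0 1 - {0}) \<and>
    N = reflected_product \<kappa> \<zeta> m"
  unfolding reflected_product_def using assms
proof (induction m arbitrary: N c \<rho>)
  case 0
  then have "degree N = 0" using circle_phase_reflect(1) by fastforce
  then obtain x where "N = [:x:]" by (auto elim: degree_eq_zeroE)
  then show ?case using 0(2) by (intro exI[of _ x]) simp
next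
  case (Suc m)
  have c: "c \<noteq> 0" and val: "\<And>x. norm x = 1 \<Longrightarrow> poly N x = c * x ^ Suc m * of_real (\<rho> x)"
    and pos: "\<And>x. norm x = 1 \<Longrightarrow> \<rho> x > 0"
    using Suc(2) unfolding circle_phase_def by auto
  have circle: "poly N x \<noteq> 0" if "norm x = 1" for x
    using val[OF that] pos[OF that] c that by auto
  have "degree N \<noteq> 0" using circle_phase_reflect(1)[OF Suc(2,3)] by simp
  then obtain r where r: "poly N r = 0"
    using fundamental_theorem_of_algebra[of N] by (auto simp: constant_degree)
  \<comment> \<open>of the two reflected roots take the one inside the disc\<close>
  define x where "x = (if norm r < 1 then r else reflect r)"
  have "r \<noteq> 0" "norm r \<noteq> 1" using r Suc(3) circle by auto
  then have x: "x \<in> ball 0 1 - {0}" by (auto simp: x_def norm_reflect) (simp add: reflect_def)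
  have "poly N x = 0" "poly N (reflect x) = 0"
    using r circle_phase_reflect(2)[OF Suc(2,3) r] by (auto simp: x_def)
  moreover have "x \<noteq> reflect x"
  proof
    assume "x = reflect x"
    then have "norm x = 1 / norm x" by (metis norm_reflect)
    then have "norm x * norm x = 1" using x by (simp add: field_simps)
    moreover have "norm x * norm x < 1 * 1" using x by (intro mult_strict_mono) auto
    ultimately show False by simp
  qed
  moreover obtain M1 where M1: "N = [:- x, 1:] * M1" using \<open>poly N x = 0\<close> by (auto simp: poly_eq_0_iff_dvd elim: dvdE)
  ultimately have "poly M1 (reflect x) = 0" by (auto simp: M1)
  then obtain M where "M1 = [:- reflect x, 1:] * M" by (auto simp: poly_eq_0_iff_dvd elim: dvdE)
  with M1 have M: "N = ([:- x, 1:] * [:- reflect x, 1:]) * M" by (simp only: mult.assoc)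
  have "circle_phase m M (- c * cnj x) (\<lambda>w. \<rho> w / (norm (w - x))\<^sup>2)"
    unfolding circle_phase_def
  proof (intro conjI allI impI)
    show "- c * cnj x \<noteq> 0" using c x by simp
    fix w :: complex assume w: "norm w = 1"
    then have "norm (w - x) > 0" "w \<noteq> 0" using x by auto
    then show "\<rho> w / (norm (w - x))\<^sup>2 > 0" using pos[OF w] by simp
    have "poly N w = (w - x) * (w - reflect x) * poly M w" unfolding M by (simp add: algebra_simps)
    also have "(w - x) * (w - reflect x) = - (w / cnj x) * of_real ((norm (w - x))\<^sup>2)"
      using x by (intro circle_diff_mult_reflect[OF w]) simp
    finally have "w * (poly M w * of_real ((norm (w - x))\<^sup>2)) = w * (- c * cnj x * w ^ m * of_real (\<rho> w))"
      unfolding val[OF w] using x by (simp add: field_simps)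
    then have "poly M w * of_real ((norm (w - x))\<^sup>2) = - c * cnj x * w ^ m * of_real (\<rho> w)"
      using \<open>w \<noteq> 0\<close> mult_left_cancel by blast
    then show "poly M w = - c * cnj x * w ^ m * of_real (\<rho> w / (norm (w - x))\<^sup>2)"
      using \<open>norm (w - x) > 0\<close> by (simp add: field_simps)
  qed
  moreover have "poly M 0 \<noteq> 0" using Suc(3) by (auto simp: M)
  ultimately obtain \<kappa> \<zeta> where IH: "\<kappa> \<noteq> 0" "\<forall>k\<in>{1..m}. \<zeta> k \<in> ball 0 1 - {0}"
      "M = smult \<kappa> (\<Prod>k=1..m. [:- \<zeta> k, 1:] * [:- reflect (\<zeta> k), 1:])"
    using Suc(1) by meson
  define \<zeta>' where "\<zeta>' = \<zeta>(Suc m := x)"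
  have "(\<Prod>k=1..Suc m. [:- \<zeta>' k, 1:] * [:- reflect (\<zeta>' k), 1:]) =
      ([:- x, 1:] * [:- reflect x, 1:]) * (\<Prod>k=1..m. [:- \<zeta> k, 1:] * [:- reflect (\<zeta> k), 1:])"
    by (simp add: \<zeta>'_def mult.commute del: mult_pCons_left mult_pCons_right)
  then have "N = smult \<kappa> (\<Prod>k=1..Suc m. [:- \<zeta>' k, 1:] * [:- reflect (\<zeta>' k), 1:])"
    unfolding M IH(3) by (simp only: mult_smult_right)
  moreover have "\<forall>k\<in>{1..Suc m}. \<zeta>' k \<in> ball 0 1 - {0}"
    using IH(2) x by (auto simp: \<zeta>'_def)
  ultimately show ?case using IH(1) by blast
qed

lemma log_deriv_reflected_product:
  assumes "poly (reflected_product \<kappa> \<zeta> m) x \<noteq> 0"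
  shows "poly (pderiv (reflected_product \<kappa> \<zeta> m)) x = poly (reflected_product \<kappa> \<zeta> m) x *
    (\<Sum>k=1..m. 1 / (x - \<zeta> k) + 1 / (x - reflect (\<zeta> k)))"
proof -
  let ?f = "\<lambda>k. [:- \<zeta> k, 1:] * [:- reflect (\<zeta> k), 1:]"
  have nz: "x \<noteq> \<zeta> k \<and> x \<noteq> reflect (\<zeta> k)" if "k \<in> {1..m}" for k
    using assms that unfolding poly_reflected_product by auto
  have "poly (pderiv (?f k)) x / poly (?f k) x = 1 / (x - \<zeta> k) + 1 / (x - reflect (\<zeta> k))" if "k \<in> {1..m}" for k
    unfolding pderiv_mult poly_add poly_mult using nz[OF that] by (simp add: pderiv_pCons field_simps)
  moreover have "poly (?f k) x \<noteq> 0" if "k \<in> {1..m}" for k using nz[OF that] unfolding poly_mult by simp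
  ultimately show ?thesis
    unfolding reflected_product_def pderiv_smult poly_smult
    by (subst log_deriv_prod) (auto simp del: mult_pCons_left mult_pCons_right)
qed

section \<open>The Vandermonde determinant\<close>

lemma permutes_UNIV_le_imp_id:
  fixes p :: "'n::{finite,linorder} \<Rightarrow> 'n"
  assumes p: "p permutes UNIV" and le: "\<And>i. p i \<le> i"
  shows "p = id"
proof (rule ccontr)
  assume "p \<noteq> id"
  then have ne: "{i. p i \<noteq> i} \<noteq> {}" by (auto simp: fun_eq_iff)
  define i where "i = Min {i. p i \<noteq> i}"
  have i: "p i \<noteq> i" using Min_in[OF _ ne] unfolding i_def by auto
  with le[of i] have "p i < i" by simp
  then have "p (p i) = p i" using Min_le[of "{i. p i \<noteq> i}" "p i"] unfolding i_def by fastforce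
  then show False using permutes_inj[OF p] i by (auto dest: injD)
qed

text \<open>
  A nontrivial permutation of a finite linear order moves some index upwards, so its term in the
  Leibniz formula contains a factor above the diagonal.
\<close>

lemma det_lower_triangular:
  fixes A :: "'a::comm_ring_1^'n::{finite,linorder}^'n::{finite,linorder}"
  assumes "\<And>i j. i < j \<Longrightarrow> A $ i $ j = 0"
  shows "det A = (\<Prod>i\<in>UNIV. A $ i $ i)"
proof -
  have "(\<Prod>i\<in>UNIV. A $ i $ p i) = 0" if p: "p \<in> {p. p permutes UNIV} - {id}" for p
  proof -
    obtain i where "p i > i" using permutes_UNIV_le_imp_id[of p] p by (metis DiffE insertI1 mem_Collect_eq not_le)
    then show ?thesis by (intro prod_zero) (auto intro!: bexI[of _ i] assms)
  qed
  then have "det A = (\<Sum>p\<in>{id}. of_int (sign p) * (\<Prod>i\<in>UNIV. A $ i $ p i))"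
    unfolding det_def by (intro sum.mono_neutral_right) (auto simp: permutes_id)
  then show ?thesis by simp
qed

text \<open>
  The Newton polynomials \<open>\<Prod>\<^bsub>l<m\<^esub> (x - w\<^sub>l)\<close> are monic and their degrees are the ranks of the indices, so
  they form a triangular basis. For the evaluation of the Vandermonde determinant it matters that
  the coefficients vanish above \<open>i\<close> and that the coefficient at \<open>i\<close> is the leading one.
\<close>

lemma newton_expansion:
  fixes w :: "'n::{finite,linorder} \<Rightarrow> 'a::field"
  assumes "degree q \<le> card {..<i}"
  shows "\<exists>t. t i = coeff q (card {..<i}) \<and> (\<forall>m>i. t m = 0) \<and>
    q = (\<Sum>m\<in>UNIV. smult (t m) (\<Prod>l\<in>{..<m}. [:- w l, 1:]))"
  using assms
proof (induction "card {..<i}" arbitrary: i q)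
  case 0
  have e: "{..<i} = {}" using 0(1) by simp
  obtain x where x: "q = [:x:]" using 0 degree_eq_zeroE by auto
  show ?case
    by (intro exI[of _ "\<lambda>m. if m = i then x else 0"])
       (auto simp: x e if_distrib[of "\<lambda>t. smult t _"] cong: if_cong)
next
  case (Suc r)
  \<comment> \<open>the predecessor of \<open>i\<close>; after removal of the leading term the degree is at most its rank\<close>
  define i' where "i' = Max {..<i}"
  define x where "x = coeff q (card {..<i})"
  let ?p = "\<lambda>m. \<Prod>l\<in>{..<m}. [:- w l, 1:]"
  define s where "s = q - smult x (?p i)"
  have ne: "{..<i} \<noteq> {}" using Suc(2) by auto
  have "i' < i" using Max_in[OF _ ne] unfolding i'_def by auto
  have "{..<i} = insert i' {..<i'}"
    using \<open>i' < i\<close> Max_ge[of "{..<i}"] unfolding i'_def by (auto simp: le_less)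
  then have r: "r = card {..<i'}" using Suc(2) by simp
  have mon: "degree (?p i) = card {..<i}" "coeff (?p i) (card {..<i}) = 1"
    by (simp_all add: monic_prod_linear)
  have "degree s \<le> card {..<i}" unfolding s_def
    using Suc(3) degree_smult_le[of x "?p i"] mon by (intro degree_diff_le) auto
  moreover have "coeff s (card {..<i}) = 0" using mon by (simp add: s_def x_def)
  ultimately have "degree s \<le> card {..<i'}" using Suc(2) r
    by (metis degree_0 eq_zero_or_degree_less le0 less_Suc_eq_le)
  from Suc(1)[OF r this] obtain t where t: "\<forall>m>i'. t m = 0"
    "s = (\<Sum>m\<in>UNIV. smult (t m) (?p m))" by blast
  have "q = smult x (?p i) + s" by (simp add: s_def)
  also have "s = (\<Sum>m\<in>UNIV-{i}. smult (t m) (?p m))"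
    unfolding t(2) using t(1) \<open>i' < i\<close> by (intro sum.mono_neutral_right) auto
  also have "smult x (?p i) + \<dots> = (\<Sum>m\<in>UNIV. smult ((t(i := x)) m) (?p m))"
    by (subst sum.remove[of UNIV i]) auto
  finally show ?case using t(1) \<open>i' < i\<close>
    by (intro exI[of _ "t(i := x)"]) (auto simp: x_def)
qed

text \<open>
  The exponents are the ranks \<open>0, \<dots>, n - 1\<close> of the column indices in the linear order.
\<close>

definition vandermonde :: "('n::{finite,linorder} \<Rightarrow> 'a::comm_ring_1) \<Rightarrow> 'a^'n::{finite,linorder}^'n::{finite,linorder}" where
  "vandermonde w = (\<chi> j i. w j ^ card {..<i})"

text \<open>
  The passage from monomials to Newton polynomials is unitriangular, and the matrix of the Newton
  polynomials evaluated at their own nodes is lower triangular.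
\<close>

lemma det_vandermonde:
  fixes w :: "'n::{finite,linorder} \<Rightarrow> 'a::field"
  shows "det (vandermonde w) = (\<Prod>i\<in>UNIV. \<Prod>l\<in>{..<i}. w i - w l)"
proof -
  let ?p = "\<lambda>m. \<Prod>l\<in>{..<m}. [:- w l, 1:]"
  have "\<forall>i. \<exists>t. t i = 1 \<and> (\<forall>m>i. t m = 0) \<and> monom 1 (card {..<i}) = (\<Sum>m\<in>UNIV. smult (t m) (?p m))"
  proof
    fix i
    show "\<exists>t. t i = 1 \<and> (\<forall>m>i. t m = 0) \<and> monom 1 (card {..<i}) = (\<Sum>m\<in>UNIV. smult (t m) (?p m))"
    using newton_expansion[of "monom 1 (card {..<i})" i w] by (simp add: degree_monom_eq)
  qed
  from choice[OF this]
  obtain t where t: "\<And>i. t i i = 1" "\<And>i m. m > i \<Longrightarrow> t i m = 0"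
    "\<And>i. monom 1 (card {..<i}) = (\<Sum>m\<in>UNIV. smult (t i m) (?p m))" by blast
  define A where "A = (\<chi> j m. poly (?p m) (w j))"
  define T where "T = (\<chi> i m. t i m)"
  have "w j ^ card {..<i} = (\<Sum>m\<in>UNIV. t i m * poly (?p m) (w j))" for i j
    using arg_cong[OF t(3)[of i], of "\<lambda>p. poly p (w j)"] by (simp add: poly_monom poly_sum)
  then have "vandermonde w = A ** transpose T"
    unfolding vandermonde_def A_def T_def matrix_matrix_mult_def transpose_def
    by (simp add: vec_eq_iff mult.commute)
  then have "det (vandermonde w) = det A * det T" by (simp add: det_mul)
  also have "det T = 1" by (subst det_lower_triangular) (auto simp: T_def t)
  also have "det A = (\<Prod>i\<in>UNIV. \<Prod>l\<in>{..<i}. w i - w l)"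
    by (subst det_lower_triangular) (auto simp: A_def poly_prod intro!: prod_zero)
  finally show ?thesis by simp
qed

section \<open>Hadamard's inequality\<close>

lemma norm_vec_square_complex: "complex_of_real ((norm x)\<^sup>2) = (\<Sum>k\<in>UNIV. x $ k * cnj (x $ k))"
  for x :: "complex^'n"
  unfolding norm_vec_def L2_set_def
  by (subst real_sqrt_pow2) (auto intro: sum_nonneg simp: complex_norm_square[symmetric])

text \<open>
  Subtracting from \<open>x\<close> its projection onto \<open>y\<close> shortens it unless the two are orthogonal.
\<close>

lemma norm_orthogonal_part_less:
  fixes x y :: "complex^'n"
  assumes "(\<Sum>k\<in>UNIV. x $ k * cnj (y $ k)) \<noteq> 0"
  shows "\<exists>c. norm (x + c *s y) < norm x"
proof -
  define h where "h = (\<Sum>k\<in>UNIV. x $ k * cnj (y $ k))"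
  define Y where "Y = complex_of_real ((norm y)\<^sup>2)"
  have "y \<noteq> 0" using assms by auto
  then have Y0: "Y \<noteq> 0" by (simp add: Y_def)
  define c where "c = - h / Y"
  have hc: "cnj h = (\<Sum>k\<in>UNIV. y $ k * cnj (x $ k))"
    unfolding h_def by (simp add: mult.commute)
  have "complex_of_real ((norm (x + c *s y))\<^sup>2) =
      (norm x)\<^sup>2 + cnj c * h + c * cnj h + c * cnj c * Y"
    unfolding norm_vec_square_complex hc unfolding h_def Y_def norm_vec_square_complex
    by (simp add: algebra_simps sum_distrib_left sum.distrib)
  also have "cnj Y = Y" by (simp add: Y_def)
  then have "(norm x)\<^sup>2 + cnj c * h + c * cnj h + c * cnj c * Y = complex_of_real ((norm x)\<^sup>2) - h * cnj h / Y"
    unfolding c_def using Y0 by (simp add: field_simps)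
  also have "h * cnj h / Y = complex_of_real ((norm h)\<^sup>2 / (norm y)\<^sup>2)"
    by (simp add: Y_def complex_norm_square[symmetric])
  finally have "(norm (x + c *s y))\<^sup>2 = (norm x)\<^sup>2 - (norm h)\<^sup>2 / (norm y)\<^sup>2"
    by (simp only: of_real_diff[symmetric] of_real_eq_iff)
  moreover have "(norm h)\<^sup>2 / (norm y)\<^sup>2 > 0" using assms \<open>y \<noteq> 0\<close> by (simp add: h_def)
  ultimately have "(norm (x + c *s y))\<^sup>2 < (norm x)\<^sup>2" by linarith
  then show ?thesis using power_less_imp_less_base norm_ge_zero by blast
qed

lemma cnj_det: "cnj (det A) = det (\<chi> i j. cnj (A $ i $ j))" for A :: "complex^'n^'n"
  by (simp add: det_def)

lemma det_square_orthogonal_rows: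
  fixes M :: "complex^'n^'n"
  assumes "\<And>i j. i \<noteq> j \<Longrightarrow> (\<Sum>k\<in>UNIV. M $ i $ k * cnj (M $ j $ k)) = 0"
  shows "(norm (det M))\<^sup>2 = (\<Prod>i\<in>UNIV. (norm (M $ i))\<^sup>2)"
proof -
  define C where "C = (\<chi> i j. cnj (M $ i $ j))"
  have "complex_of_real ((norm (det M))\<^sup>2) = det (M ** transpose C)"
    by (simp add: complex_norm_square cnj_det C_def det_mul flip: of_real_power)
  also have "\<dots> = (\<Prod>i\<in>UNIV. complex_of_real ((norm (M $ i))\<^sup>2))"
    by (subst det_diagonal)
       (auto simp: matrix_matrix_mult_def transpose_def C_def assms norm_vec_square_complex simp del: of_real_power)
  finally show ?thesis by (simp only: of_real_prod[symmetric] of_real_eq_iff)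
qed

lemma of_real_smult_eq_scaleR: "complex_of_real r *s x = r *\<^sub>R x" for x :: "complex^'n"
  unfolding vec_eq_iff vector_scaleR_component by (simp add: scaleR_conv_of_real)

text \<open>
  By compactness \<open>|det M|\<close> attains its maximum over the matrices with rows in the unit ball. At a
  maximizer the rows are orthogonal: otherwise a row operation, which leaves the determinant
  unchanged, would shorten one row, and rescaling this row to length one would increase the
  determinant. For orthogonal rows the determinant is the product of the norms of the rows.
\<close>

lemma hadamard_unit_rows:
  fixes A :: "complex^'n^'n"
  assumes "\<And>i. norm (A $ i) \<le> 1"
  shows "norm (det A) \<le> 1"
proof -
  define S where "S = {M :: complex^'n^'n. \<forall>i. norm (M $ i) \<le> 1}"
  have "closed S" unfolding S_def by (intro closed_Collect_all closed_Collect_le continuous_intros)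
  moreover have "norm M \<le> (\<Sum>i\<in>(UNIV::'n set). 1)" if "M \<in> S" for M
    unfolding norm_vec_def[of M] using that
    by (intro order_trans[OF L2_set_le_sum] sum_mono) (auto simp: S_def)
  then have "bounded S" unfolding bounded_iff by blast
  ultimately have "compact S" by (simp add: compact_eq_bounded_closed)
  moreover have I: "mat 1 \<in> S"
  proof -
    have "mat 1 $ i = (axis i 1 :: complex^'n)" for i by (simp add: mat_def axis_def vec_eq_iff eq_commute)
    then show ?thesis by (simp add: S_def)
  qed
  moreover have "continuous_on S (\<lambda>M. norm (det M))" unfolding det_def by (intro continuous_intros)
  ultimately obtain M where M: "M \<in> S" and max: "\<And>X. X \<in> S \<Longrightarrow> norm (det X) \<le> norm (det M)"
    using continuous_attains_sup[of S "\<lambda>M. norm (det M)"] by blast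
  have dM: "norm (det M) \<ge> 1" using max[OF I] by simp
  have rows: "norm (M $ i) \<le> 1" for i using M by (simp add: S_def)
  have "(\<Sum>k\<in>UNIV. M $ i $ k * cnj (M $ j $ k)) = 0" if "i \<noteq> j" for i j
  proof (rule ccontr)
    assume "(\<Sum>k\<in>UNIV. M $ i $ k * cnj (M $ j $ k)) \<noteq> 0"
    then obtain c where c: "norm (M $ i + c *s M $ j) < norm (M $ i)"
      using norm_orthogonal_part_less by blast
    define v where "v = M $ i + c *s M $ j"
    define u where "u = inverse (complex_of_real (norm v)) *s v"
    define X where "X y = (\<chi> k. if k = i then y else M $ k)" for y
    have v1: "norm v < 1" using c rows[of i] unfolding v_def by linarith
    have det: "det (X v) = det M"
    proof -
      have "row k M = M $ k" for k by (simp add: row_def)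
      then show ?thesis
        using det_row_operation[OF \<open>i \<noteq> j\<close>, of M c] by (simp only: X_def v_def)
    qed
    have "v \<noteq> 0"
    proof
      assume "v = 0"
      then have "det (X v) = 0" by (intro det_zero_row(1)[of i]) (simp add: X_def row_def vec_eq_iff)
      then show False using det dM by simp
    qed
    have uv: "v = complex_of_real (norm v) *s u"
      using \<open>v \<noteq> 0\<close> by (simp add: u_def vec_eq_iff)
    have "u = inverse (norm v) *\<^sub>R v"
      by (simp add: u_def of_real_smult_eq_scaleR flip: of_real_inverse)
    then have "norm u = 1" using \<open>v \<noteq> 0\<close> by simp
    then have "X u \<in> S" using rows by (auto simp: S_def X_def)
    have "det (X v) = complex_of_real (norm v) * det (X u)"
      unfolding X_def by (subst uv) (rule det_row_mul)
    then have "norm (det M) = norm v * norm (det (X u))" using det by (simp add: norm_mult)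
    also have "\<dots> \<le> norm v * norm (det M)" using max[OF \<open>X u \<in> S\<close>] by (intro mult_left_mono) auto
    also have "\<dots> < 1 * norm (det M)" using v1 dM by (intro mult_strict_right_mono) auto
    finally show False by simp
  qed
  then have "(norm (det M))\<^sup>2 = (\<Prod>i\<in>UNIV. (norm (M $ i))\<^sup>2)" by (rule det_square_orthogonal_rows)
  also have "\<dots> \<le> 1" using rows by (intro prod_le_1) (auto simp: power_le_one)
  finally have "norm (det M) \<le> 1" by (simp add: power_le_one_iff abs_square_le_1)
  then show ?thesis using max[of A] assms by (auto simp: S_def)
qed

lemma hadamard_inequality:
  fixes A :: "complex^'n^'n"
  shows "norm (det A) \<le> (\<Prod>i\<in>UNIV. norm (A $ i))"
proof (cases "\<exists>i. A $ i = 0")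
  case True
  then obtain i where "row i A = 0" by (auto simp: row_def)
  then have "det A = 0" by (rule det_zero_row)
  then show ?thesis by (simp add: prod_nonneg)
next
  case False
  define r where "r i = norm (A $ i)" for i
  have r: "r i > 0" for i using False by (auto simp: r_def)
  define U where "U = (\<chi> i. complex_of_real (inverse (r i)) *s A $ i)"
  have "norm (U $ i) = inverse (r i) * r i" for i
    by (simp add: U_def of_real_smult_eq_scaleR r_def del: of_real_inverse)
  then have "norm (U $ i) \<le> 1" for i using r[of i] by simp
  then have "norm (det U) \<le> 1" by (rule hadamard_unit_rows)
  moreover define R where "R = (\<Prod>i\<in>UNIV. r i)"
  have "det U = complex_of_real (inverse R) * det A"
    unfolding U_def det_rows_mul vec_lambda_eta of_real_prod[symmetric] R_def prod_inversef[symmetric]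
    by (simp add: comp_def)
  then have "norm (det U) = inverse \<bar>R\<bar> * norm (det A)" by (simp add: norm_mult norm_inverse)
  moreover have "R > 0" using r by (simp add: R_def prod_pos)
  ultimately show ?thesis by (simp add: R_def r_def field_simps)
qed

section \<open>Extremality of the nodes\<close>

text \<open>
  Interpolation of the monomials at the nodes \<open>z\<close>: the Lagrange matrix takes the values of a
  polynomial of degree less than \<open>n\<close> at \<open>z\<close> to its values at \<open>w\<close>.
\<close>

lemma det_vandermonde_change_nodes:
  fixes z w :: "'n::{finite,linorder} \<Rightarrow> 'a::field"
  assumes "inj z"
  shows "det (vandermonde w) = det (\<chi> j k. poly (lagrange z k) (w j)) * det (vandermonde z)"
proof -
  have "w j ^ card {..<i} = (\<Sum>k\<in>UNIV. poly (lagrange z k) (w j) * z k ^ card {..<i})" for i j :: 'n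
  proof -
    define p where "p = monom (1::'a) (card {..<i})"
    have "card {..<i} < CARD('n)" by (intro psubset_card_mono) auto
    then have "degree p < CARD('n)" by (simp add: p_def degree_monom_eq)
    then have "p = (\<Sum>k\<in>UNIV. smult (poly p (z k)) (lagrange z k))"
      using lagrange_interpolation[OF \<open>inj z\<close>, of p] by (simp add: coeff_eq_0)
    then have "poly p (w j) = poly (\<Sum>k\<in>UNIV. smult (poly p (z k)) (lagrange z k)) (w j)" by (rule arg_cong)
    then show ?thesis by (simp add: poly_sum p_def poly_monom mult.commute)
  qed
  then have "vandermonde w = (\<chi> j k. poly (lagrange z k) (w j)) ** vandermonde z"
    by (simp add: vandermonde_def matrix_matrix_mult_def)
  then show ?thesis by (simp add: det_mul)
qed

text \<open>
  Hadamard's inequality for the matrix \<open>(L\<^sub>k(w\<^sub>j) |N(z\<^sub>k)|\<^bsup>1/2\<^esup>)\<^sub>j\<^sub>k\<close>: its determinant is the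
  quotient of the two Vandermonde determinants times \<open>\<Prod>\<^sub>k |N(z\<^sub>k)|\<^bsup>1/2\<^esup>\<close>, and the square of the norm
  of its row \<open>j\<close> is \<open>|N(w\<^sub>j)|\<close>.
\<close>

lemma vandermonde_minimality:
  fixes z w :: "'n::{finite,linorder} \<Rightarrow> complex"
  assumes "inj z" and z: "\<And>k. norm (z k) = 1" and w: "\<And>k. norm (w k) = 1"
    and phase: "circle_phase (CARD('n) - 1) N c \<rho>"
    and N: "N = (\<Sum>k\<in>UNIV. smult (poly N (z k)) ((lagrange z k)\<^sup>2))"
  shows "(norm (det (vandermonde w)))\<^sup>2 * (\<Prod>k\<in>UNIV. norm (poly N (z k)))
    \<le> (norm (det (vandermonde z)))\<^sup>2 * (\<Prod>k\<in>UNIV. norm (poly N (w k)))"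
proof -
  define L where "L = (\<chi> j k. poly (lagrange z k) (w j))"
  define s where "s k = sqrt (norm (poly N (z k)))" for k
  define S where "S = (\<chi> (j::'n) (k::'n). if j = k then complex_of_real (s j) else 0)"
  have s: "s k \<ge> 0" "(s k)\<^sup>2 = norm (poly N (z k))" for k by (simp_all add: s_def)
  have LS: "(L ** S) $ j $ k = poly (lagrange z k) (w j) * of_real (s k)" for j k
    by (simp add: L_def S_def matrix_matrix_mult_def if_distrib[of "(*) _"] cong: if_cong)
  have row: "(norm ((L ** S) $ j))\<^sup>2 = norm (poly N (w j))" for j
    unfolding norm_vec_def L2_set_def norm_sum_lagrange_squares[OF z w phase N]
    by (subst real_sqrt_pow2) (auto intro: sum_nonneg simp: LS norm_mult power_mult_distrib s mult.commute)
  have dS: "det S = of_real (\<Prod>k\<in>UNIV. s k)" by (subst det_diagonal) (auto simp: S_def)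
  have "(norm (det L))\<^sup>2 * (\<Prod>k\<in>UNIV. norm (poly N (z k))) = (norm (det (L ** S)))\<^sup>2"
    unfolding det_mul norm_mult dS power_mult_distrib s(2)[symmetric] prod_power_distrib[symmetric]
    by (simp del: of_real_prod)
  also have "\<dots> \<le> (\<Prod>j\<in>UNIV. norm ((L ** S) $ j))\<^sup>2"
    by (intro power_mono hadamard_inequality) simp
  also have "\<dots> = (\<Prod>j\<in>UNIV. norm (poly N (w j)))" unfolding prod_power_distrib row ..
  finally have "(norm (det L))\<^sup>2 * (\<Prod>k\<in>UNIV. norm (poly N (z k))) \<le> (\<Prod>j\<in>UNIV. norm (poly N (w j)))" .
  then have "(norm (det (vandermonde z)))\<^sup>2 * ((norm (det L))\<^sup>2 * (\<Prod>k\<in>UNIV. norm (poly N (z k))))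
     \<le> (norm (det (vandermonde z)))\<^sup>2 * (\<Prod>j\<in>UNIV. norm (poly N (w j)))"
    by (intro mult_left_mono) auto
  then show ?thesis
    unfolding det_vandermonde_change_nodes[OF \<open>inj z\<close>, of w] L_def[symmetric]
    by (simp add: norm_mult power_mult_distrib mult_ac)
qed

section \<open>The energy and its gradient\<close>

lemma sum_swap_less:
  fixes f :: "'n::{finite,linorder} \<Rightarrow> 'n \<Rightarrow> 'b::comm_monoid_add"
  shows "(\<Sum>j\<in>UNIV. \<Sum>k\<in>{j<..}. f j k) = (\<Sum>k\<in>UNIV. \<Sum>j\<in>{..<k}. f j k)"
  using sum.swap_restrict[of UNIV UNIV f "\<lambda>j k. j < k"] by (simp add: greaterThan_def lessThan_def)

lemma ln_mult_prod:
  fixes x :: real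
  assumes "finite S" "x > 0" and f: "\<And>k. k \<in> S \<Longrightarrow> f k > 0"
  shows "ln (x * prod f S) = ln x + (\<Sum>k\<in>S. ln (f k))"
proof -
  have "prod f S > 0" using f by (rule prod_pos)
  moreover have "f k \<noteq> 0" if "k \<in> S" for k using f[OF that] by simp
  ultimately show ?thesis using assms(1,2) by (simp add: ln_mult_pos ln_prod)
qed

text \<open>
  Up to the contribution of the leading coefficient of \<open>N\<close>, the attraction by the roots of \<open>N\<close> adds
  up to \<open>ln |N|\<close> at each point, and the mutual repulsion is a Vandermonde determinant.
\<close>

lemma W_eq_ln:
  fixes w :: "complex ^ 'n::{finite,linorder}"
  assumes N: "N = reflected_product \<kappa> \<zeta> (CARD('n) - 1)"
    and nz: "\<And>j. poly N (w $ j) \<noteq> 0" and inj: "inj (($) w)"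
  shows "W \<zeta> w = ln (\<Prod>j\<in>UNIV. norm (poly N (w $ j))) - of_nat CARD('n) * ln (norm \<kappa>)
     - ln ((norm (det (vandermonde (($) w))))\<^sup>2)"
proof -
  have factors: "(w $ j - \<zeta> k) * (w $ j - reflect (\<zeta> k)) \<noteq> 0" if "k \<in> {1..CARD('n) - 1}" for j k
    using nz[of j] that unfolding N poly_reflected_product by auto
  have "\<kappa> \<noteq> 0" using nz unfolding N poly_reflected_product by auto
  define f where "f j k = norm ((w $ j - \<zeta> k) * (w $ j - reflect (\<zeta> k)))" for j k
  have "norm (poly N (w $ j)) = norm \<kappa> * (\<Prod>k=1..CARD('n) - 1. f j k)" for j
    unfolding N poly_reflected_product norm_mult[of \<kappa>] prod_norm f_def ..
  moreover have "f j k > 0" if "k \<in> {1..CARD('n) - 1}" for j k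
    unfolding f_def zero_less_norm_iff by (rule factors[OF that])
  ultimately have "ln (norm (poly N (w $ j))) = ln (norm \<kappa>) + (\<Sum>k=1..CARD('n) - 1. ln (f j k))" for j
    using \<open>\<kappa> \<noteq> 0\<close> by (auto intro!: ln_mult_prod)
  then have "(\<Sum>j\<in>UNIV. ln (norm (poly N (w $ j)))) = of_nat CARD('n) * ln (norm \<kappa>) +
      (\<Sum>j\<in>UNIV. \<Sum>k=1..CARD('n) - 1. ln (f j k))"
    by (simp add: sum.distrib)
  also have "(\<Sum>j\<in>UNIV. ln (norm (poly N (w $ j)))) = ln (\<Prod>j\<in>UNIV. norm (poly N (w $ j)))"
    using nz by (simp add: ln_prod)
  finally have 1: "(\<Sum>k=1..CARD('n) - 1. \<Sum>j\<in>UNIV. ln (f j k))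
     = ln (\<Prod>j\<in>UNIV. norm (poly N (w $ j))) - of_nat CARD('n) * ln (norm \<kappa>)"
    by (subst sum.swap) simp
  have "ln (norm (det (vandermonde (($) w)))) = (\<Sum>i\<in>UNIV. \<Sum>l\<in>{..<i}. ln (norm (w $ i - w $ l)))"
    unfolding det_vandermonde prod_norm[symmetric]
    using inj_eq[OF inj] by (subst ln_prod) (auto intro!: sum.cong ln_prod)
  also have "\<dots> = (\<Sum>j\<in>UNIV. \<Sum>k\<in>{j<..}. ln (norm (w $ j - w $ k)))"
    unfolding sum_swap_less by (simp add: norm_minus_commute)
  finally show ?thesis unfolding W_def f_def[symmetric] 1 by (simp add: ln_realpow)
qed

lemma has_derivative_ln_norm:
  fixes f :: "'a::real_normed_vector \<Rightarrow> complex"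
  assumes f: "(f has_derivative f') (at x)" and nz: "f x \<noteq> 0"
  shows "((\<lambda>x. ln (norm (f x))) has_derivative (\<lambda>h. Re (f' h / f x))) (at x)"
proof -
  have "((\<lambda>x. norm (f x)) has_derivative (\<lambda>h. inner (f' h) (sgn (f x)))) (at x)"
    using has_derivative_compose[OF f has_derivative_norm[OF nz]] .
  then have "((\<lambda>x. ln (norm (f x))) has_derivative (\<lambda>h. inner (f' h) (sgn (f x)) * inverse (norm (f x)))) (at x)"
    by (rule has_derivative_ln[rotated]) (use nz in simp)
  moreover have "inner a (sgn (f x)) * inverse (norm (f x)) = Re (a / f x)" for a
  proof -
    have "a / f x = (a * cnj (f x)) / complex_of_real ((norm (f x))\<^sup>2)"
      using complex_div_cnj[of a "f x"] by simp
    then show ?thesis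
      by (simp only: Re_divide_of_real)
         (simp add: sgn_div_norm inner_complex_def power2_eq_square divide_inverse algebra_simps)
  qed
  ultimately show ?thesis by simp
qed

text \<open>
  Each logarithm \<open>ln |f|\<close> is the real part of a branch of \<open>log f\<close>, so the real derivative of \<open>W\<close> is
  the real part of a complex linear form. Its coefficients are the forces at the points
  \<open>z\<^sub>j\<close>; in the repulsion term each unordered pair of indices contributes to both of its members.
\<close>

lemma W_has_derivative:
  fixes z :: "complex ^ 'n::{finite,linorder}"
  assumes inj: "inj (($) z)"
    and nz: "\<And>j k. k \<in> {1..CARD('n) - 1} \<Longrightarrow> z $ j \<noteq> \<zeta> k \<and> z $ j \<noteq> reflect (\<zeta> k)"
  shows "(W \<zeta> has_derivative (\<lambda>h. Re (\<Sum>j\<in>UNIV. h $ j *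
     ((\<Sum>k=1..CARD('n) - 1. 1 / (z $ j - \<zeta> k) + 1 / (z $ j - reflect (\<zeta> k)))
       - 2 * (\<Sum>m\<in>-{j}. 1 / (z $ j - z $ m)))))) (at z)"
proof -
  define a where "a k j = 1 / (z $ j - \<zeta> k) + 1 / (z $ j - reflect (\<zeta> k))" for k j
  define b where "b j m = 1 / (z $ j - z $ m)" for j m
  have comp: "((\<lambda>w. w $ j) has_derivative (\<lambda>h. h $ j)) (at z)" for j
    by (intro bounded_linear_imp_has_derivative bounded_linear_vec_nth)
  have A: "((\<lambda>w. ln (norm ((w $ j - \<zeta> k) * (w $ j - reflect (\<zeta> k))))) has_derivative
      (\<lambda>h. Re (h $ j * a k j))) (at z)" if "k \<in> {1..CARD('n) - 1}" for k j
  proof -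
    have "((\<lambda>w. (w $ j - \<zeta> k) * (w $ j - reflect (\<zeta> k))) has_derivative
       (\<lambda>h. (z $ j - \<zeta> k) * h $ j + h $ j * (z $ j - reflect (\<zeta> k)))) (at z)"
      by (auto intro!: derivative_eq_intros comp)
    from has_derivative_ln_norm[OF this] nz[OF that, of j]
    have "((\<lambda>w. ln (norm ((w $ j - \<zeta> k) * (w $ j - reflect (\<zeta> k))))) has_derivative
        (\<lambda>h. Re (((z $ j - \<zeta> k) * h $ j + h $ j * (z $ j - reflect (\<zeta> k))) /
          ((z $ j - \<zeta> k) * (z $ j - reflect (\<zeta> k)))))) (at z)"
      by (simp only: mult_eq_0_iff right_minus_eq simp_thms)
    moreover have "((z $ j - \<zeta> k) * x + x * (z $ j - reflect (\<zeta> k))) /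
        ((z $ j - \<zeta> k) * (z $ j - reflect (\<zeta> k))) = x * a k j" for x
      unfolding a_def using nz[OF that, of j] by (simp add: divide_simps) (simp add: algebra_simps)
    ultimately show ?thesis by (simp only:)
  qed
  have B: "((\<lambda>w. ln (norm (w $ j - w $ m))) has_derivative (\<lambda>h. Re (h $ j * b j m + h $ m * b m j))) (at z)"
    if "m \<in> {j<..}" for j m
  proof -
    have ne: "z $ j - z $ m \<noteq> 0" using inj_eq[OF inj, of j m] that by auto
    have "((\<lambda>w. w $ j - w $ m) has_derivative (\<lambda>h. h $ j - h $ m)) (at z)"
      by (auto intro!: derivative_eq_intros comp)
    from has_derivative_ln_norm[OF this ne] have
      "((\<lambda>w. ln (norm (w $ j - w $ m))) has_derivative (\<lambda>h. Re ((h $ j - h $ m) / (z $ j - z $ m)))) (at z)" .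
    moreover have "(x - y) / (z $ j - z $ m) = x * b j m + y * b m j" for x y
      unfolding b_def using ne by (simp add: divide_simps) (simp add: algebra_simps)
    ultimately show ?thesis by (simp only:)
  qed
  have eq: "(\<Sum>k=1..CARD('n) - 1. \<Sum>j\<in>UNIV. Re (h $ j * a k j)) -
      2 * (\<Sum>j\<in>UNIV. \<Sum>m\<in>{j<..}. Re (h $ j * b j m + h $ m * b m j)) =
      Re (\<Sum>j\<in>UNIV. h $ j * ((\<Sum>k=1..CARD('n) - 1. a k j) - 2 * (\<Sum>m\<in>-{j}. b j m)))" for h :: "complex^'n::{finite,linorder}"
  proof -
    have split: "- {j} = {j<..} \<union> {..<j}" for j :: 'n by auto
    have "(\<Sum>j\<in>UNIV. \<Sum>m\<in>{j<..}. h $ j * b j m + h $ m * b m j) =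
        (\<Sum>j\<in>UNIV. (\<Sum>m\<in>{j<..}. h $ j * b j m) + (\<Sum>m\<in>{..<j}. h $ j * b j m))"
      by (simp add: sum.distrib sum_swap_less[of "\<lambda>j m. h $ m * b m j"])
    also have "\<dots> = (\<Sum>j\<in>UNIV. h $ j * (\<Sum>m\<in>-{j}. b j m))"
      unfolding split by (subst sum.union_disjoint) (auto simp: sum_distrib_left algebra_simps)
    finally have "(\<Sum>k=1..CARD('n) - 1. \<Sum>j\<in>UNIV. h $ j * a k j) -
      2 * (\<Sum>j\<in>UNIV. \<Sum>m\<in>{j<..}. h $ j * b j m + h $ m * b m j) =
      (\<Sum>j\<in>UNIV. h $ j * ((\<Sum>k=1..CARD('n) - 1. a k j) - 2 * (\<Sum>m\<in>-{j}. b j m)))"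
      by (subst sum.swap) (simp add: sum_distrib_left sum_subtractf right_diff_distrib mult_ac)
    from arg_cong[OF this, of Re] show ?thesis by (simp add: Re_sum)
  qed
  have "(W \<zeta> has_derivative (\<lambda>h. (\<Sum>k=1..CARD('n) - 1. \<Sum>j\<in>UNIV. Re (h $ j * a k j)) -
      2 * (\<Sum>j\<in>UNIV. \<Sum>m\<in>{j<..}. Re (h $ j * b j m + h $ m * b m j)))) (at z)"
    unfolding W_def[abs_def]
    by (intro has_derivative_diff has_derivative_sum has_derivative_mult_right A B)
  then show ?thesis unfolding eq unfolding a_def b_def .
qed

section \<open>The minimum\<close>

theorem theorem2:
  fixes z :: "complex ^ 'n::{finite,linorder}" and B :: "complex \<Rightarrow> complex"
  assumes "z \<in> torus"
    and "\<And>j k. j \<noteq> k \<Longrightarrow> z $ j \<noteq> z $ k"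
    and "blaschke_product CARD('n) B"
    and "\<And>j. B (z $ j) = 1"
    and "deriv B 0 \<noteq> 0"
  shows "\<exists>\<zeta> :: nat \<Rightarrow> complex.
           (\<forall>k\<in>{1..CARD('n) - 1}. \<zeta> k \<in> ball 0 1 - {0}) \<and>
           (GDERIV (W \<zeta>) z :> 0) \<and>
           (\<forall>w\<in>torus :: (complex ^ 'n::{finite,linorder}) set. W_torus \<zeta> z \<le> W_torus \<zeta> w)"
proof -
  let ?n = "CARD('n)"
  obtain c a where c: "norm c = 1" and a: "\<And>k. k \<in> {1..?n} \<Longrightarrow> norm (a k) < 1"
    and B: "B = (\<lambda>x. c * (\<Prod>k=1..?n. (x - a k) / (1 - cnj (a k) * x)))"
    using assms(3) unfolding blaschke_product_def by blast
  define P Q N where "P = blaschke_num c a ?n" and "Q = blaschke_den a ?n" and "N = wronskian P Q"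
  have BPQ: "B = (\<lambda>x. poly P x / poly Q x)"
    unfolding B P_def Q_def blaschke_eq_quotient ..
  have zn: "norm (z $ j) = 1" for j using assms(1) by (simp add: torus_def)
  have inj: "inj (($) z)" using assms(2) by (auto simp: inj_def)
  have "?n \<ge> 1" by (simp add: Suc_le_eq)
  then obtain \<rho> where phase: "circle_phase (?n - 1) N c \<rho>"
    using circle_phase_wronskian_blaschke[of ?n c a] a c unfolding N_def P_def Q_def by force
  then have circle: "poly N x \<noteq> 0" if "norm x = 1" for x
    using that unfolding circle_phase_def by force
  \<comment> \<open>a zero of the denominator would give the value zero instead of one\<close>
  have "poly Q (z $ j) \<noteq> 0" for j using assms(4)[of j] unfolding BPQ by auto
  then have "poly P (z $ j) = poly Q (z $ j)" for j using assms(4)[of j] unfolding BPQ by simp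
  moreover have "degree P \<le> ?n" "degree Q \<le> ?n"
    unfolding P_def Q_def blaschke_num_def blaschke_den_def
    by (intro order_trans[OF degree_smult_le] degree_prod_linear_le)+
  ultimately have N: "N = (\<Sum>k\<in>UNIV. smult (poly N (z $ k)) ((lagrange (($) z) k)\<^sup>2))"
    unfolding N_def by (intro wronskian_eq_sum_lagrange_squares inj)
  \<comment> \<open>the derivative of \<open>B\<close> at the origin is \<open>N(0) / Q(0)\<^sup>2\<close>\<close>
  have "poly Q 0 = 1" by (simp add: Q_def blaschke_den_def poly_prod)
  then have "(B has_field_derivative poly N 0) (at 0)"
    unfolding BPQ N_def wronskian_def by (auto intro!: derivative_eq_intros)
  then have "poly N 0 \<noteq> 0" using assms(5) DERIV_imp_deriv by metis
  then obtain \<kappa> \<zeta> where \<zeta>: "\<forall>k\<in>{1..?n - 1}. \<zeta> k \<in> ball 0 1 - {0}"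
    and fac: "N = reflected_product \<kappa> \<zeta> (?n - 1)"
    using circle_phase_factorization[OF phase] by blast
  have crit: "(\<Sum>k=1..?n - 1. 1 / (z $ j - \<zeta> k) + 1 / (z $ j - reflect (\<zeta> k)))
      = 2 * (\<Sum>m\<in>-{j}. 1 / (z $ j - z $ m))" for j
    using pderiv_sum_lagrange_squares[OF inj N, of j] circle[OF zn[of j]]
      log_deriv_reflected_product[of \<kappa> \<zeta> "?n - 1" "z $ j"]
    unfolding fac[symmetric] by simp
  have "z $ j \<noteq> \<zeta> k \<and> z $ j \<noteq> reflect (\<zeta> k)" if "k \<in> {1..?n - 1}" for j k
    using circle[OF zn[of j]] that unfolding fac poly_reflected_product by auto
  from W_has_derivative[where \<zeta> = \<zeta>, OF inj this] have "GDERIV (W \<zeta>) z :> 0"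
    unfolding gderiv_def by (simp only: crit) simp
  moreover have "W_torus \<zeta> z \<le> W_torus \<zeta> w" if "w \<in> torus" for w :: "complex^'n::{finite,linorder}"
  proof (cases "inj (($) w)")
    case False
    then show ?thesis by (auto simp: W_torus_def inj_def)
  next
    case True
    have wn: "norm (w $ j) = 1" for j using that by (simp add: torus_def)
    let ?D = "\<lambda>v::complex^'n::{finite,linorder}. (norm (det (vandermonde (($) v))))\<^sup>2"
    let ?E = "\<lambda>v::complex^'n::{finite,linorder}. \<Prod>j\<in>UNIV. norm (poly N (v $ j))"
    have E: "?E v > 0" if "\<And>j. norm (v $ j) = 1" for v using circle[OF that] by (auto intro: prod_pos)
    have D: "?D v > 0" if "inj (($) v)" for v
      using inj_eq[OF that] by (auto simp: det_vandermonde)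
    have "?D w * ?E z \<le> ?D z * ?E w"
      by (rule vandermonde_minimality[OF inj zn wn phase N])
    then have "ln (?D w * ?E z) \<le> ln (?D z * ?E w)"
      using D E inj True zn wn by (subst ln_le_cancel_iff) (auto intro: mult_pos_pos)
    then have "ln (?D w) + ln (?E z) \<le> ln (?D z) + ln (?E w)"
      using D[OF inj] D[OF True] E[of z, OF zn] E[of w, OF wn] by (simp only: ln_mult_pos)
    then have "W \<zeta> z \<le> W \<zeta> w"
      unfolding W_eq_ln[OF fac circle[OF zn] inj] W_eq_ln[OF fac circle[OF wn] True] by linarith
    then show ?thesis using inj_eq[OF inj] inj_eq[OF True] by (auto simp: W_torus_def)
  qed
  ultimately show ?thesis using \<zeta> by blast
qed

end
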